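(* Let $X_1,X_2,X_3$ be Polish spaces, $\mu_i\in\mathcal{P}(X_i)$, $\mu_{ij}=\mu_i\otimes\mu_j$ for $1\le i<j\le3$, and let $c:X_1\times X_2\times X_3\to[0,\infty)$ be bounded and continuous. Let $\{f_{ij}\}$ be a solution to the dual problem, i.e. $f_{ij}\in L^1(X_i\times X_j,\mu_{ij})$ real-valued with $f_{12}(x_1,x_2)+f_{13}(x_1,x_3)+f_{23}(x_2,x_3)\le c(x_1,x_2,x_3)$ for all $x$, maximizing $\sum_{i<j}\int f_{ij}\,d\mu_{ij}$ among all such tuples. Then $$f_{12}(x_1,x_2)+f_{13}(x_1,x_3)+f_{23}(x_2,x_3)\ge-12\|c\|_\infty$$ for $\mu_1\otimes\mu_2\otimes\mu_3$-almost every $x$. *)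

theory Defs
  imports "HOL-Probability.Probability"
begin

definition sup_norm :: "('a \<Rightarrow> real) \<Rightarrow> real" where
  "sup_norm c = (SUP x. \<bar>c x\<bar>)"

definition dual_admissible ::
  "'a measure \<Rightarrow> 'b measure \<Rightarrow> 'c measure \<Rightarrow> ('a \<times> 'b \<times> 'c \<Rightarrow> real) \<Rightarrow>
   ('a \<times> 'b \<Rightarrow> real) \<Rightarrow> ('a \<times> 'c \<Rightarrow> real) \<Rightarrow> ('b \<times> 'c \<Rightarrow> real) \<Rightarrow> bool" where
  "dual_admissible M1 M2 M3 c f12 f13 f23 \<longleftrightarrow>
     integrable (M1 \<Otimes>\<^sub>M M2) f12 \<and> integrable (M1 \<Otimes>\<^sub>M M3) f13 \<and>
     integrable (M2 \<Otimes>\<^sub>M M3) f23 \<and>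
     (\<forall>x1 x2 x3. f12 (x1, x2) + f13 (x1, x3) + f23 (x2, x3) \<le> c (x1, x2, x3))"

definition dual_value ::
  "'a measure \<Rightarrow> 'b measure \<Rightarrow> 'c measure \<Rightarrow>
   ('a \<times> 'b \<Rightarrow> real) \<Rightarrow> ('a \<times> 'c \<Rightarrow> real) \<Rightarrow> ('b \<times> 'c \<Rightarrow> real) \<Rightarrow> real" where
  "dual_value M1 M2 M3 f12 f13 f23 =
     (\<integral>z. f12 z \<partial>(M1 \<Otimes>\<^sub>M M2)) + (\<integral>z. f13 z \<partial>(M1 \<Otimes>\<^sub>M M3)) +
     (\<integral>z. f23 z \<partial>(M2 \<Otimes>\<^sub>M M3))"

end

theory Submission
  imports Defs
begin

text \<open>
  Write \<open>K\<close> for the bound on the cost, \<open>F = f + g + h\<close> for the optimal sum and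
  \<open>V = \<integral>F\<close>, so \<open>V \<ge> 0\<close> because the zero tuple is admissible.
  First, integrating \<open>F\<close> over two variables gives at least \<open>V - K\<close> for almost every value of
  the third: otherwise replace the sections at the bad points \<open>x\<close> by the sections at a point \<open>s\<close>
  whose average is at least \<open>V\<close>, lowered by \<open>K\<close>; this is admissible and improves the value.
  Secondly, integrating \<open>F \<le> K\<close> in one variable bounds \<open>g(x,t)\<close> and \<open>h(y,t)\<close> from above by
  marginals, so \<open>g(x,t) + h(y,t) \<le> - L(x,y)\<close> for a function \<open>L\<close> that does not depend
  on \<open>t\<close>; replacing \<open>f\<close> by \<open>max f L\<close> is admissible, and optimality forces \<open>f \<ge> L\<close>
  almost everywhere. Adding the three bounds of the second kind and estimating the marginals by
  the first yields \<open>F \<ge> 4V - 12K\<close>.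
\<close>

text \<open>The exceptional set is needed as a concrete object: the modified tuples are defined by
  cases on membership in it, and admissibility is tested at every point.\<close>

lemma AE_obtain_null_set:
  assumes "AE x in M. P x" "space M = UNIV"
  obtains N where "N \<in> null_sets M" "\<And>x. x \<notin> N \<Longrightarrow> P x"
  using assms unfolding eventually_ae_filter by auto

section \<open>Product measures: exchange of factors and functions of one coordinate\<close>

context pair_sigma_finite
begin

lemma integral_case_prod_swap:
  fixes f :: "'a \<Rightarrow> 'b \<Rightarrow> real"
  assumes "integrable (M1 \<Otimes>\<^sub>M M2) (case_prod f)"
  shows "integrable (M2 \<Otimes>\<^sub>M M1) (\<lambda>(y, x). f x y)"
    and "(\<integral>(y, x). f x y \<partial>(M2 \<Otimes>\<^sub>M M1)) = (\<integral>(x, y). f x y \<partial>(M1 \<Otimes>\<^sub>M M2))"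
  using integrable_product_swap[OF assms] integral_product_swap[of "case_prod f"] assms by auto

lemma AE_pair_fst:
  assumes "AE x in M1. P x"
  shows "AE (x, y) in M1 \<Otimes>\<^sub>M M2. P x"
proof -
  obtain N where N: "N \<in> null_sets M1" "{x \<in> space M1. \<not> P x} \<subseteq> N"
    using assms unfolding eventually_ae_filter by auto
  then have "N \<times> space M2 \<in> null_sets (M1 \<Otimes>\<^sub>M M2)"
    by auto
  then show ?thesis
    by (rule AE_I') (use N in \<open>auto simp: space_pair_measure\<close>)
qed

lemma AE_pair_snd:
  assumes "AE y in M2. P y"
  shows "AE (x, y) in M1 \<Otimes>\<^sub>M M2. P y"
proof -
  obtain N where N: "N \<in> null_sets M2" "{y \<in> space M2. \<not> P y} \<subseteq> N"
    using assms unfolding eventually_ae_filter by auto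
  then have "space M1 \<times> N \<in> null_sets (M1 \<Otimes>\<^sub>M M2)"
    by auto
  then show ?thesis
    by (rule AE_I') (use N in \<open>auto simp: space_pair_measure\<close>)
qed

end

context pair_prob_space
begin

lemma integrable_pair_fst:
  fixes u :: "'a \<Rightarrow> real"
  assumes "integrable M1 u"
  shows "integrable (M1 \<Otimes>\<^sub>M M2) (\<lambda>(x, y). u x)"
  using assms by (intro Fubini_integrable) auto

lemma integrable_pair_snd:
  fixes v :: "'b \<Rightarrow> real"
  assumes "integrable M2 v"
  shows "integrable (M1 \<Otimes>\<^sub>M M2) (\<lambda>(x, y). v y)"
  using assms by (intro Fubini_integrable) auto

end

section \<open>Optimal dual tuples and permutations of the variables\<close>

locale dual_solution =
  P1: prob_space M1 + P2: prob_space M2 + P3: prob_space M3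
  for M1 :: "'a measure" and M2 :: "'b measure" and M3 :: "'c measure" +
  fixes c :: "'a \<Rightarrow> 'b \<Rightarrow> 'c \<Rightarrow> real"
    and f :: "'a \<Rightarrow> 'b \<Rightarrow> real" and g :: "'a \<Rightarrow> 'c \<Rightarrow> real" and h :: "'b \<Rightarrow> 'c \<Rightarrow> real"
    and K V :: real
  assumes space_UNIV: "space M1 = UNIV" "space M2 = UNIV" "space M3 = UNIV"
    and c_nonneg: "0 \<le> c x y z" and c_le: "c x y z \<le> K"
    and int: "integrable (M1 \<Otimes>\<^sub>M M2) (case_prod f)" "integrable (M1 \<Otimes>\<^sub>M M3) (case_prod g)"
      "integrable (M2 \<Otimes>\<^sub>M M3) (case_prod h)"
    and le_c: "f x y + g x z + h y z \<le> c x y z"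
    and V: "V = (\<integral>p. case_prod f p \<partial>(M1 \<Otimes>\<^sub>M M2)) + (\<integral>p. case_prod g p \<partial>(M1 \<Otimes>\<^sub>M M3))
      + (\<integral>p. case_prod h p \<partial>(M2 \<Otimes>\<^sub>M M3))"
    and le_V: "\<lbrakk>integrable (M1 \<Otimes>\<^sub>M M2) (case_prod f'); integrable (M1 \<Otimes>\<^sub>M M3) (case_prod g');
      integrable (M2 \<Otimes>\<^sub>M M3) (case_prod h');
      \<And>x y z. f' x y + g' x z + h' y z \<le> c x y z\<rbrakk>
      \<Longrightarrow> (\<integral>p. case_prod f' p \<partial>(M1 \<Otimes>\<^sub>M M2)) + (\<integral>p. case_prod g' p \<partial>(M1 \<Otimes>\<^sub>M M3))
        + (\<integral>p. case_prod h' p \<partial>(M2 \<Otimes>\<^sub>M M3)) \<le> V"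
begin

sublocale P12: pair_prob_space M1 M2 ..
sublocale P13: pair_prob_space M1 M3 ..
sublocale P23: pair_prob_space M2 M3 ..

lemma V_nonneg: "0 \<le> V"
  using le_V[of "\<lambda>_ _. 0" "\<lambda>_ _. 0" "\<lambda>_ _. 0"] c_nonneg by (simp add: case_prod_unfold)

text \<open>The locale is closed under permuting the variables: this transposition and
  \<open>swap23\<close> generate all of them. Hence each estimate is proved for one variable or one
  component only and then transported, with \<open>K\<close> and \<open>V\<close> unchanged.\<close>

lemma swap12: "dual_solution M2 M1 M3 (\<lambda>y x. c x y) (\<lambda>y x. f x y) h g K V"
proof
  interpret P21: pair_prob_space M2 M1 ..
  fix f' h' g'
  assume *: "integrable (M2 \<Otimes>\<^sub>M M1) (case_prod f')" "integrable (M2 \<Otimes>\<^sub>M M3) (case_prod h')"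
    "integrable (M1 \<Otimes>\<^sub>M M3) (case_prod g')"
    "\<And>y x z. f' y x + h' y z + g' x z \<le> c x y z"
  show "(\<integral>p. case_prod f' p \<partial>(M2 \<Otimes>\<^sub>M M1)) + (\<integral>p. case_prod h' p \<partial>(M2 \<Otimes>\<^sub>M M3))
        + (\<integral>p. case_prod g' p \<partial>(M1 \<Otimes>\<^sub>M M3)) \<le> V"
    using le_V[of "\<lambda>x y. f' y x" g' h'] * P21.integral_case_prod_swap[OF *(1)]
    by (simp add: algebra_simps)
next
  show "f x y + h y z + g x z \<le> c x y z" for x y z
    using le_c[of x y z] by simp
qed (use P12.integral_case_prod_swap[OF int(1)] in \<open>simp_all add: space_UNIV c_nonneg c_le int V\<close>)

lemma swap23: "dual_solution M1 M3 M2 (\<lambda>x z y. c x y z) g f (\<lambda>z y. h y z) K V"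
proof
  interpret P32: pair_prob_space M3 M2 ..
  fix f' h' g'
  assume *: "integrable (M1 \<Otimes>\<^sub>M M3) (case_prod g')" "integrable (M1 \<Otimes>\<^sub>M M2) (case_prod f')"
    "integrable (M3 \<Otimes>\<^sub>M M2) (case_prod h')"
    "\<And>x z y. g' x z + f' x y + h' z y \<le> c x y z"
  show "(\<integral>p. case_prod g' p \<partial>(M1 \<Otimes>\<^sub>M M3)) + (\<integral>p. case_prod f' p \<partial>(M1 \<Otimes>\<^sub>M M2))
        + (\<integral>p. case_prod h' p \<partial>(M3 \<Otimes>\<^sub>M M2)) \<le> V"
    using le_V[of f' g' "\<lambda>y z. h' z y"] * P32.integral_case_prod_swap[OF *(3)]
    by (simp add: algebra_simps)
next
  show "g x z + f x y + h y z \<le> c x y z" for x y z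
    using le_c[of x y z] by simp
qed (use P23.integral_case_prod_swap[OF int(3)] in \<open>simp_all add: space_UNIV c_nonneg c_le int V\<close>)

section \<open>Lower bounds for the averages over two variables\<close>

lemma AE_integrable_sections:
  "AE x in M1. integrable M2 (f x) \<and> integrable M3 (g x)"
  using P12.AE_integrable_fst[OF int(1)] P13.AE_integrable_fst[OF int(2)] by eventually_elim simp

lemma AE_fst_marginal_ge:
  "AE x in M1. V - K \<le> (\<integral>y. f x y \<partial>M2) + (\<integral>z. g x z \<partial>M3) + (\<integral>p. case_prod h p \<partial>(M2 \<Otimes>\<^sub>M M3))"
proof -
  define Ih where "Ih = (\<integral>p. case_prod h p \<partial>(M2 \<Otimes>\<^sub>M M3))"
  define \<phi> where "\<phi> x = (\<integral>y. f x y \<partial>M2) + (\<integral>z. g x z \<partial>M3) + Ih" for x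
  have int_f: "integrable M1 (\<lambda>x. \<integral>y. f x y \<partial>M2)" by (rule P12.integrable_fst[OF int(1)])
  have int_g: "integrable M1 (\<lambda>x. \<integral>z. g x z \<partial>M3)" by (rule P13.integrable_fst[OF int(2)])
  have int_\<phi>[measurable]: "integrable M1 \<phi>"
    unfolding \<phi>_def using int_f int_g by auto
  have integral_\<phi>: "(\<integral>x. \<phi> x \<partial>M1) = V"
    unfolding \<phi>_def using int_f int_g P12.integral_fst[OF int(1)] P13.integral_fst[OF int(2)]
    by (simp add: V Ih_def P1.prob_space)
  \<comment> \<open>A point with \<open>\<phi> s\<close> at least the mean \<open>V\<close> exists,
    since otherwise \<open>\<phi> < V\<close> almost everywhere. It is chosen with integrable
    sections because these sections become part of a competitor.\<close>
  obtain s where s: "integrable M2 (f s)" "integrable M3 (g s)" "V \<le> \<phi> s"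
  proof (rule ccontr)
    assume "\<not> thesis"
    with that have "\<phi> x < V" if "integrable M2 (f x) \<and> integrable M3 (g x)" for x
      using that by force
    from eventually_mono[OF AE_integrable_sections this] have "AE x in M1. \<phi> x < V" .
    then show False
      using P1.expectation_less[OF int_\<phi>, of V] integral_\<phi> by simp
  qed
  define B where "B = {x. \<phi> x < V - K}"
  have B[measurable]: "B \<in> sets M1"
  proof -
    have "{x \<in> space M1. \<phi> x < V - K} \<in> sets M1" by measurable
    then show ?thesis by (simp add: B_def space_UNIV)
  qed
  \<comment> \<open>For \<open>x\<close> in \<open>B\<close> the new sum is at most
    \<open>c s y z - K\<close>, hence at most 0, so it lies below \<open>c x y z\<close>. Its
    average \<open>\<phi> s - K\<close> is at least \<open>V - K\<close>, hence exceeds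
    \<open>\<phi> x\<close> on \<open>B\<close>.\<close>
  define f' where "f' x y = (if x \<in> B then f s y - K else f x y)" for x y
  define g' where "g' x z = (if x \<in> B then g s z else g x z)" for x z
  have if_int: "integrable (M1 \<Otimes>\<^sub>M N) (\<lambda>(x, y). if x \<in> B then u y else v x y)"
    if N: "prob_space N" and u: "integrable N u" and v: "integrable (M1 \<Otimes>\<^sub>M N) (case_prod v)"
    for N :: "'d measure" and u :: "'d \<Rightarrow> real" and v
  proof -
    interpret N: prob_space N by fact
    interpret PN: pair_prob_space M1 N ..
    have m: "B \<times> space N \<in> sets (M1 \<Otimes>\<^sub>M N)" "(- B) \<times> space N \<in> sets (M1 \<Otimes>\<^sub>M N)"
      using B sets.compl_sets[OF B] by (auto simp: space_UNIV Compl_eq_Diff_UNIV)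
    have "integrable (M1 \<Otimes>\<^sub>M N) (\<lambda>p. indicat_real (B \<times> space N) p * (case p of (x, y) \<Rightarrow> u y)
      + indicat_real ((- B) \<times> space N) p * case_prod v p)"
      using m PN.integrable_pair_snd[OF u] v
      by (intro Bochner_Integration.integrable_add) 
         (auto intro!: integrable_real_mult_indicator simp: mult.commute[of "indicat_real _ _"])
    then show ?thesis
      by (rule Bochner_Integration.integrable_cong[THEN iffD1, rotated -1])
         (auto simp: space_pair_measure indicator_def)
  qed
  have int': "integrable (M1 \<Otimes>\<^sub>M M2) (case_prod f')" "integrable (M1 \<Otimes>\<^sub>M M3) (case_prod g')"
    unfolding f'_def g'_def
    using if_int[OF P2.prob_space_axioms, of "\<lambda>y. f s y - K" f]
      if_int[OF P3.prob_space_axioms, of "g s" g] s int by auto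
  have f'g': "(\<integral>y. f' x y \<partial>M2) + (\<integral>z. g' x z \<partial>M3) + Ih = (if x \<in> B then \<phi> s - K else \<phi> x)" for x
    using s by (simp add: f'_def g'_def \<phi>_def P2.prob_space)
  have "(\<integral>p. case_prod f' p \<partial>(M1 \<Otimes>\<^sub>M M2)) + (\<integral>p. case_prod g' p \<partial>(M1 \<Otimes>\<^sub>M M3))
        + (\<integral>p. case_prod h p \<partial>(M2 \<Otimes>\<^sub>M M3)) \<le> V"
  proof (rule le_V[OF int' int(3)])
    fix x y z
    show "f' x y + g' x z + h y z \<le> c x y z"
      using le_c[of x y z] le_c[of s y z] c_le[of s y z] c_nonneg[of x y z]
      by (simp add: f'_def g'_def)
  qed
  also have "(\<integral>p. case_prod f' p \<partial>(M1 \<Otimes>\<^sub>M M2)) + (\<integral>p. case_prod g' p \<partial>(M1 \<Otimes>\<^sub>M M3))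
      + (\<integral>p. case_prod h p \<partial>(M2 \<Otimes>\<^sub>M M3))
      = (\<integral>x. (\<integral>y. f' x y \<partial>M2) + (\<integral>z. g' x z \<partial>M3) + Ih \<partial>M1)"
    using P12.integrable_fst[OF int'(1)] P13.integrable_fst[OF int'(2)]
      P12.integral_fst[OF int'(1)] P13.integral_fst[OF int'(2)]
    by (simp add: Ih_def P1.prob_space)
  finally have le: "(\<integral>x. (if x \<in> B then \<phi> s - K else \<phi> x) \<partial>M1) \<le> (\<integral>x. \<phi> x \<partial>M1)"
    by (simp add: f'g' integral_\<phi>)
  have int_\<psi>: "integrable M1 (\<lambda>x. if x \<in> B then \<phi> s - K else \<phi> x)"
    using P12.integrable_fst[OF int'(1)] P13.integrable_fst[OF int'(2)]
    unfolding f'g'[symmetric] by auto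
  have ge: "0 \<le> (if x \<in> B then \<phi> s - K else \<phi> x) - \<phi> x" for x
    using s by (auto simp: B_def)
  have "(\<integral>x. (if x \<in> B then \<phi> s - K else \<phi> x) - \<phi> x \<partial>M1) = 0"
  proof (rule antisym)
    show "(\<integral>x. (if x \<in> B then \<phi> s - K else \<phi> x) - \<phi> x \<partial>M1) \<le> 0"
      using le int_\<psi> int_\<phi> by simp
  qed (rule Bochner_Integration.integral_nonneg[OF ge])
  then have "AE x in M1. (if x \<in> B then \<phi> s - K else \<phi> x) - \<phi> x = 0"
    using ge int_\<psi> int_\<phi> by (subst (asm) integral_nonneg_eq_0_iff_AE) auto
  \<comment> \<open>The gain is strictly positive on \<open>B\<close>, so its vanishing almost
    everywhere makes \<open>B\<close> null.\<close>
  then have "AE x in M1. V - K \<le> \<phi> x"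
    by eventually_elim (use s in \<open>auto simp: B_def split: if_splits\<close>)
  then show ?thesis
    by (simp add: \<phi>_def Ih_def)
qed

lemma AE_snd_marginal_ge:
  "AE y in M2. V - K \<le> (\<integral>x. f x y \<partial>M1) + (\<integral>z. h y z \<partial>M3) + (\<integral>p. case_prod g p \<partial>(M1 \<Otimes>\<^sub>M M3))"
  by (rule dual_solution.AE_fst_marginal_ge[OF swap12])

lemma AE_thd_marginal_ge:
  "AE z in M3. V - K \<le> (\<integral>x. g x z \<partial>M1) + (\<integral>y. h y z \<partial>M2) + (\<integral>p. case_prod f p \<partial>(M1 \<Otimes>\<^sub>M M2))"
  by (rule dual_solution.AE_snd_marginal_ge[OF swap23])

section \<open>A pointwise lower bound for a single component\<close>

lemma AE_pair_ge:
  "AE (x, y) in M1 \<Otimes>\<^sub>M M2. (\<integral>y. f x y \<partial>M2) + (\<integral>x. f x y \<partial>M1)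
     - (\<integral>p. case_prod f p \<partial>(M1 \<Otimes>\<^sub>M M2)) - 3 * K + V \<le> f x y"
proof -
  define If where "If = (\<integral>p. case_prod f p \<partial>(M1 \<Otimes>\<^sub>M M2))"
  \<comment> \<open>Add the averages of \<open>F \<le> K\<close> over \<open>x\<close> and over
    \<open>y\<close>, both at third coordinate \<open>t\<close>. This costs \<open>2 * K\<close>;
    the marginals of \<open>g\<close> and \<open>h\<close> at \<open>t\<close> sum to at least
    \<open>V - K - If\<close>, which costs the third \<open>K\<close> and supplies \<open>V\<close>
    and \<open>If\<close>.\<close>
  define L where "L x y = (\<integral>y. f x y \<partial>M2) + (\<integral>x. f x y \<partial>M1) - If - 3 * K + V" for x y
  obtain N1 where N1: "N1 \<in> null_sets M1" "\<And>x. x \<notin> N1 \<Longrightarrow> integrable M2 (f x)"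
    "\<And>x. x \<notin> N1 \<Longrightarrow> integrable M3 (g x)"
    using AE_integrable_sections space_UNIV(1) by (rule AE_obtain_null_set) auto
  obtain N2 where N2: "N2 \<in> null_sets M2" "\<And>y. y \<notin> N2 \<Longrightarrow> integrable M1 (\<lambda>x. f x y)"
    "\<And>y. y \<notin> N2 \<Longrightarrow> integrable M3 (h y)"
    using dual_solution.AE_integrable_sections[OF swap12] space_UNIV(2)
    by (rule AE_obtain_null_set) auto
  have "AE z in M3. integrable M1 (\<lambda>x. g x z) \<and> integrable M2 (\<lambda>y. h y z) \<and>
      V - K \<le> (\<integral>x. g x z \<partial>M1) + (\<integral>y. h y z \<partial>M2) + If"
    using AE_thd_marginal_ge P13.AE_integrable_snd[OF int(2)] P23.AE_integrable_snd[OF int(3)]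
    unfolding If_def by eventually_elim simp
  then obtain N3 where N3: "N3 \<in> null_sets M3" 
    "\<And>z. z \<notin> N3 \<Longrightarrow> integrable M1 (\<lambda>x. g x z)" "\<And>z. z \<notin> N3 \<Longrightarrow> integrable M2 (\<lambda>y. h y z)"
    "\<And>z. z \<notin> N3 \<Longrightarrow> V - K \<le> (\<integral>x. g x z \<partial>M1) + (\<integral>y. h y z \<partial>M2) + If"
    using space_UNIV(3) by (rule AE_obtain_null_set) auto
  have "N3 \<noteq> UNIV"
    using N3(1) P3.emeasure_space_1 by (auto simp: space_UNIV)
  then obtain s where s: "s \<notin> N3" by auto
  have L_le: "L x y + g x t + h y t \<le> 0" if "x \<notin> N1" "y \<notin> N2" "t \<notin> N3" for x y t
  proof -
    have "(\<integral>y. f x y + g x t + h y t \<partial>M2) \<le> K"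
      using order_trans[OF le_c c_le] N1(2)[OF that(1)] N3(3)[OF that(3)]
      by (intro P2.integral_le_const) auto
    moreover have "(\<integral>y. f x y + g x t + h y t \<partial>M2) = (\<integral>y. f x y \<partial>M2) + g x t + (\<integral>y. h y t \<partial>M2)"
      using N1(2)[OF that(1)] N3(3)[OF that(3)] by (simp add: P2.prob_space)
    moreover have "(\<integral>x. f x y + g x t + h y t \<partial>M1) \<le> K"
      using order_trans[OF le_c c_le] N2(2)[OF that(2)] N3(2)[OF that(3)]
      by (intro P1.integral_le_const) auto
    moreover have "(\<integral>x. f x y + g x t + h y t \<partial>M1) = (\<integral>x. f x y \<partial>M1) + (\<integral>x. g x t \<partial>M1) + h y t"
      using N2(2)[OF that(2)] N3(2)[OF that(3)] by (simp add: P1.prob_space)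
    ultimately show ?thesis
      using N3(4)[OF that(3)] by (simp add: L_def)
  qed
  \<comment> \<open>The bound on \<open>g + h\<close> may fail for \<open>t\<close> in the null set \<open>N3\<close>, whereas admissibility is
    required everywhere; on \<open>N3\<close> the sections at \<open>s\<close> are used instead.\<close>
  define f' where "f' x y = (if x \<in> N1 \<or> y \<in> N2 then f x y else max (f x y) (L x y))" for x y
  define g' where "g' x z = (if z \<in> N3 then g x s - K else g x z)" for x z
  define h' where "h' y z = (if z \<in> N3 then h y s else h y z)" for y z
  have [measurable]: "N1 \<in> sets M1" "N2 \<in> sets M2" "N3 \<in> sets M3"
    using N1(1) N2(1) N3(1) by auto
  note [measurable] = borel_measurable_integrable[OF int(1)]
    borel_measurable_integrable[OF int(2)] borel_measurable_integrable[OF int(3)]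
  have ae3: "AE z in M3. z \<notin> N3"
    using N3(1) by (rule AE_not_in)
  \<comment> \<open>The modifications on \<open>N1\<close>, \<open>N2\<close> and \<open>N3\<close>
    affect only null sets of the products: integrability and integrals are those of
    \<open>max f L\<close>, \<open>g\<close> and \<open>h\<close>.\<close>
  have g': "AE p in M1 \<Otimes>\<^sub>M M3. case_prod g p = case_prod g' p"
    using P13.AE_pair_snd[OF ae3] by eventually_elim (auto simp: g'_def)
  have h': "AE p in M2 \<Otimes>\<^sub>M M3. case_prod h p = case_prod h' p"
    using P23.AE_pair_snd[OF ae3] by eventually_elim (auto simp: h'_def)
  have [measurable]: "case_prod g' \<in> borel_measurable (M1 \<Otimes>\<^sub>M M3)"
  proof -
    have [measurable]: "(\<lambda>x. g x s) \<in> borel_measurable M1"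
      using N3(2)[OF s] by auto
    show ?thesis unfolding g'_def by measurable
  qed
  have [measurable]: "case_prod h' \<in> borel_measurable (M2 \<Otimes>\<^sub>M M3)"
  proof -
    have [measurable]: "(\<lambda>y. h y s) \<in> borel_measurable M2"
      using N3(3)[OF s] by auto
    show ?thesis unfolding h'_def by measurable
  qed
  have int_L: "integrable (M1 \<Otimes>\<^sub>M M2) (case_prod L)"
    using P12.integrable_pair_fst[OF P12.integrable_fst[OF int(1)]]
      P12.integrable_pair_snd[OF P12.integrable_snd[OF int(1)]]
    unfolding L_def case_prod_beta by auto
  note [measurable] = borel_measurable_integrable[OF int_L]
  have int_max: "integrable (M1 \<Otimes>\<^sub>M M2) (\<lambda>p. max (case_prod f p) (case_prod L p))"
    using int(1) int_L by auto
  have f': "AE p in M1 \<Otimes>\<^sub>M M2. max (case_prod f p) (case_prod L p) = case_prod f' p"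
    using P12.AE_pair_fst[OF AE_not_in[OF N1(1)]] P12.AE_pair_snd[OF AE_not_in[OF N2(1)]]
    by eventually_elim (auto simp: f'_def)
  have [measurable]: "case_prod f' \<in> borel_measurable (M1 \<Otimes>\<^sub>M M2)"
    unfolding f'_def by measurable
  have int': "integrable (M1 \<Otimes>\<^sub>M M2) (case_prod f')" "integrable (M1 \<Otimes>\<^sub>M M3) (case_prod g')"
    "integrable (M2 \<Otimes>\<^sub>M M3) (case_prod h')"
    using integrable_cong_AE_imp[OF int_max _ f'] integrable_cong_AE_imp[OF int(2) _ g']
      integrable_cong_AE_imp[OF int(3) _ h'] by auto
  have "(\<integral>p. case_prod f' p \<partial>(M1 \<Otimes>\<^sub>M M2)) + (\<integral>p. case_prod g' p \<partial>(M1 \<Otimes>\<^sub>M M3))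
        + (\<integral>p. case_prod h' p \<partial>(M2 \<Otimes>\<^sub>M M3)) \<le> V"
  proof (rule le_V[OF int'])
    fix x y z
    have K: "0 \<le> K" using c_nonneg[of x y z] c_le[of x y z] by linarith
    \<comment> \<open>For \<open>z\<close> outside \<open>N3\<close>, either
      \<open>f' x y = f x y\<close>, or \<open>L_le\<close> bounds the sum by 0. For
      \<open>z\<close> in \<open>N3\<close> the same two cases at \<open>s\<close> bound the sum by
      \<open>K\<close> before the subtraction in \<open>g'\<close>, so by 0 after it.\<close>
    show "f' x y + g' x z + h' y z \<le> c x y z"
      using le_c[of x y z] le_c[of x y s] c_le[of x y s] c_nonneg[of x y z]
        L_le[of x y z] L_le[of x y s] s K
      by (auto simp: f'_def g'_def h'_def max_def)
  qed
  moreover have "(\<integral>p. case_prod g p \<partial>(M1 \<Otimes>\<^sub>M M3)) = (\<integral>p. case_prod g' p \<partial>(M1 \<Otimes>\<^sub>M M3))"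
    using g' by (intro integral_cong_AE) auto
  moreover have "(\<integral>p. case_prod h p \<partial>(M2 \<Otimes>\<^sub>M M3)) = (\<integral>p. case_prod h' p \<partial>(M2 \<Otimes>\<^sub>M M3))"
    using h' by (intro integral_cong_AE) auto
  moreover have "(\<integral>p. max (case_prod f p) (case_prod L p) \<partial>(M1 \<Otimes>\<^sub>M M2))
      = (\<integral>p. case_prod f' p \<partial>(M1 \<Otimes>\<^sub>M M2))"
    using f' by (intro integral_cong_AE) auto
  \<comment> \<open>Only the first integral has changed, so optimality says that passing from
    \<open>f\<close> to \<open>max f L\<close> gains nothing.\<close>
  ultimately have "(\<integral>p. max (case_prod f p) (case_prod L p) - case_prod f p \<partial>(M1 \<Otimes>\<^sub>M M2)) \<le> 0"
    using int(1) int_max V by (subst Bochner_Integration.integral_diff) auto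
  then have "(\<integral>p. max (case_prod f p) (case_prod L p) - case_prod f p \<partial>(M1 \<Otimes>\<^sub>M M2)) = 0"
    by (intro antisym Bochner_Integration.integral_nonneg) auto
  then have "AE p in M1 \<Otimes>\<^sub>M M2. max (case_prod f p) (case_prod L p) - case_prod f p = 0"
    using int(1) int_max by (subst (asm) integral_nonneg_eq_0_iff_AE) auto
  then show ?thesis
    by eventually_elim (auto simp: L_def If_def max_def split: if_splits)
qed

section \<open>Summation of the bounds and the triple product\<close>

lemma AE_AE_AE_ge:
  "AE x in M1. AE y in M2. AE z in M3. - 12 * K \<le> f x y + g x z + h y z"
proof -
  define If where "If = (\<integral>p. case_prod f p \<partial>(M1 \<Otimes>\<^sub>M M2))"
  define Ig where "Ig = (\<integral>p. case_prod g p \<partial>(M1 \<Otimes>\<^sub>M M3))"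
  define Ih where "Ih = (\<integral>p. case_prod h p \<partial>(M2 \<Otimes>\<^sub>M M3))"
  have f: "AE x in M1. AE y in M2.
      (\<integral>y. f x y \<partial>M2) + (\<integral>x. f x y \<partial>M1) - If - 3 * K + V \<le> f x y"
    using P12.AE_pair[OF AE_pair_ge] by (simp add: If_def)
  have g: "AE x in M1. AE z in M3.
      (\<integral>z. g x z \<partial>M3) + (\<integral>x. g x z \<partial>M1) - Ig - 3 * K + V \<le> g x z"
    using P13.AE_pair[OF dual_solution.AE_pair_ge[OF swap23]] by (simp add: Ig_def)
  \<comment> \<open>Applying \<open>swap12\<close> and then \<open>swap23\<close> moves
    \<open>h\<close> to the first place with its arguments in their original order.\<close>
  have h: "AE y in M2. AE z in M3.
      (\<integral>z. h y z \<partial>M3) + (\<integral>y. h y z \<partial>M2) - Ih - 3 * K + V \<le> h y z"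
    using P23.AE_pair[OF dual_solution.AE_pair_ge[OF dual_solution.swap23[OF swap12]]]
    by (simp add: Ih_def)
  show ?thesis
    using f g AE_fst_marginal_ge
  proof eventually_elim
    case (elim x)
    note x = this
    show ?case
      using elim(1) h AE_snd_marginal_ge
    proof eventually_elim
      case (elim y)
      show ?case
        using x(2) elim(2) AE_thd_marginal_ge
      proof eventually_elim
        case z: (elim z)
        \<comment> \<open>The three component bounds contribute
          \<open>3 * V - 9 * K - (If + Ig + Ih)\<close> besides the six marginals. Grouped by
          variable, the marginals total at least \<open>3 * (V - K) - (If + Ig + Ih)\<close>. As
          \<open>If + Ig + Ih = V\<close>, the sum is at least \<open>4 * V - 12 * K\<close>, and
          \<open>V\<close> is nonnegative.\<close>
        show ?case
          using x(3) elim(1,3) z V V_nonneg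
          unfolding If_def[symmetric] Ig_def[symmetric] Ih_def[symmetric] by linarith
      qed
    qed
  qed
qed

end

theorem mainTheorem15:
  fixes M1 :: "'a::polish_space measure" and M2 :: "'b::polish_space measure"
    and M3 :: "'c::polish_space measure"
    and c :: "'a \<times> 'b \<times> 'c \<Rightarrow> real"
    and f12 :: "'a \<times> 'b \<Rightarrow> real" and f13 :: "'a \<times> 'c \<Rightarrow> real"
    and f23 :: "'b \<times> 'c \<Rightarrow> real"
  assumes "prob_space M1" "sets M1 = sets borel"
    and "prob_space M2" "sets M2 = sets borel"
    and "prob_space M3" "sets M3 = sets borel"
    and "\<And>x. c x \<ge> 0" "bounded (range c)" "continuous_on UNIV c"
    and "dual_admissible M1 M2 M3 c f12 f13 f23"
    and "\<And>g12 g13 g23. dual_admissible M1 M2 M3 c g12 g13 g23 \<Longrightarrow>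
           dual_value M1 M2 M3 g12 g13 g23 \<le> dual_value M1 M2 M3 f12 f13 f23"
  shows "AE x in M1 \<Otimes>\<^sub>M (M2 \<Otimes>\<^sub>M M3).
           f12 (fst x, fst (snd x)) + f13 (fst x, snd (snd x)) + f23 (fst (snd x), snd (snd x))
             \<ge> - 12 * sup_norm c"
proof -
  interpret P1: prob_space M1 by fact
  interpret P2: prob_space M2 by fact
  interpret P3: prob_space M3 by fact
  have "bdd_above (range (\<lambda>x. \<bar>c x\<bar>))"
    using \<open>bounded (range c)\<close> by (auto simp: bounded_iff bdd_above_def)
  then have c_le: "c x \<le> sup_norm c" for x
    unfolding sup_norm_def by (rule cSUP_upper2[of _ _ x]) auto
  have integrable_f: "integrable (M1 \<Otimes>\<^sub>M M2) f12" "integrable (M1 \<Otimes>\<^sub>M M3) f13"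
    "integrable (M2 \<Otimes>\<^sub>M M3) f23"
    and le_c: "\<And>x y z. f12 (x, y) + f13 (x, z) + f23 (y, z) \<le> c (x, y, z)"
    using assms(10) by (auto simp: dual_admissible_def)
  have space: "space M1 = UNIV" "space M2 = UNIV" "space M3 = UNIV"
    using assms(2,4,6)[THEN sets_eq_imp_space_eq] by auto
  interpret dual_solution M1 M2 M3 "\<lambda>x y z. c (x, y, z)" "curry f12" "curry f13" "curry f23"
    "sup_norm c" "dual_value M1 M2 M3 f12 f13 f23"
  proof
    fix f' g' h'
    assume "integrable (M1 \<Otimes>\<^sub>M M2) (case_prod f')" "integrable (M1 \<Otimes>\<^sub>M M3) (case_prod g')"
      "integrable (M2 \<Otimes>\<^sub>M M3) (case_prod h')"
      "\<And>x y z. f' x y + g' x z + h' y z \<le> c (x, y, z)"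
    then show "(\<integral>p. case_prod f' p \<partial>(M1 \<Otimes>\<^sub>M M2)) + (\<integral>p. case_prod g' p \<partial>(M1 \<Otimes>\<^sub>M M3))
        + (\<integral>p. case_prod h' p \<partial>(M2 \<Otimes>\<^sub>M M3)) \<le> dual_value M1 M2 M3 f12 f13 f23"
      using assms(11)[of "case_prod f'" "case_prod g'" "case_prod h'"]
      by (simp add: dual_admissible_def dual_value_def)
  qed (use integrable_f le_c c_le assms(7) space in \<open>simp_all add: dual_value_def curry_def\<close>)
  interpret Q: pair_prob_space M1 "M2 \<Otimes>\<^sub>M M3" ..
  note [measurable] = integrable_f[THEN borel_measurable_integrable]
  let ?P = "\<lambda>x. f12 (fst x, fst (snd x)) + f13 (fst x, snd (snd x)) + f23 (fst (snd x), snd (snd x))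
    \<ge> - 12 * sup_norm c"
  \<comment> \<open>An iterated almost-everywhere statement yields one for the product only for a
    measurable set; the inner product uses the sections of this same set.\<close>
  have sets: "{x \<in> space (M1 \<Otimes>\<^sub>M (M2 \<Otimes>\<^sub>M M3)). ?P x} \<in> sets (M1 \<Otimes>\<^sub>M (M2 \<Otimes>\<^sub>M M3))"
    by measurable
  have "AE p in M2 \<Otimes>\<^sub>M M3. ?P (x, p)"
    if "AE y in M2. AE z in M3. ?P (x, y, z)" for x
  proof (rule P23.AE_pair_measure[OF _ that])
    have "{p \<in> space (M2 \<Otimes>\<^sub>M M3). ?P (x, p)} =
        Pair x -` {x \<in> space (M1 \<Otimes>\<^sub>M (M2 \<Otimes>\<^sub>M M3)). ?P x}"
      by (simp add: space_pair_measure space vimage_def)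
    then show "{p \<in> space (M2 \<Otimes>\<^sub>M M3). ?P (x, p)} \<in> sets (M2 \<Otimes>\<^sub>M M3)"
      using sets_Pair1[OF sets, of x] by simp
  qed
  with AE_AE_AE_ge have "AE x in M1. AE p in M2 \<Otimes>\<^sub>M M3. ?P (x, p)"
    by (auto elim!: eventually_mono)
  with sets show ?thesis
    by (rule Q.AE_pair_measure)
qed

end
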